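(* Let $G,H$ be finite prelinear Hilbert algebras (not necessarily bounded). Let $G^0\coprod_{\mathsf{PHil_0}}H^0$ be the coproduct of $G^0$ and $H^0$ in the category $\mathsf{PHil_0}$ of bounded prelinear Hilbert algebras, with canonical morphisms $j_{G^0}:G^0\to G^0\coprod_{\mathsf{PHil_0}}H^0$ and $j_{H^0}:H^0\to G^0\coprod_{\mathsf{PHil_0}}H^0$. Let $i_G:G\to G^0$, $i_H:H\to H^0$ be the inclusions, and put $k_G=j_{G^0}\circ i_G$ and $k_H=j_{H^0}\circ i_H$. Let $G\ast H$ be the Hilbert subalgebra (with respect to $\to,1$) of $G^0\coprod_{\mathsf{PHil_0}}H^0$ generated by $k_G(G)\cup k_H(H)$. Then $G\ast H$, with the injections $k_G:G\to G\ast H$ and $k_H:H\to G\ast H$, is the coproduct of $G$ and $H$ in the category $\mathsf{PHil}$ of prelinear Hilbert algebras.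
   Context: A Hilbert algebra is an algebra $(H,\to,1)$ of type $(2,0)$ such that for all $a,b,c\in H$: $a\to(b\to a)=1$; $(a\to(b\to c))\to((a\to b)\to(a\to c))=1$; and $a\to b=b\to a=1$ implies $a=b$. Its natural order is $a\le b$ iff $a\to b=1$. A Hilbert chain is a Hilbert algebra whose natural order is total; a prelinear Hilbert algebra is a member of the variety generated by the Hilbert chains. $\mathsf{PHil}$ is the category of prelinear Hilbert algebras with homomorphisms (preserving $\to,1$). A bounded prelinear Hilbert algebra is $(H,\to,1,0)$ with $(H,\to,1)$ a prelinear Hilbert algebra and $0\le a$ for all $a$; morphisms of $\mathsf{PHil_0}$ preserve $\to,1,0$. For a prelinear Hilbert algebra $H$, $H^0=(H\sqcup\{0\},\to_0,1,0)$ is the bounded prelinear Hilbert algebra with universe the disjoint union of $H$ and a new element $0$, and $h\to_0k=h\to k$ for $h,k\in H$; $0\to_0h=1$ for all $h\in H\cup\{0\}$; $h\to_00=0$ for $h\in H$. *)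

theory Defs
  imports "HOL-Library.FuncSet" "HOL-Library.Countable_Set" "HOL-Library.Infinite_Typeclass"
begin

record 'a hilbert =
  carrier :: "'a set"
  imp :: "'a \<Rightarrow> 'a \<Rightarrow> 'a"
  unt :: 'a

record 'a bhilbert = "'a hilbert" +
  bot_elt :: 'a

definition hilbert_algebra :: "('a, 'z) hilbert_scheme \<Rightarrow> bool" where
  "hilbert_algebra H \<longleftrightarrow>
     unt H \<in> carrier H \<and>
     (\<forall>a\<in>carrier H. \<forall>b\<in>carrier H. imp H a b \<in> carrier H) \<and>
     (\<forall>a\<in>carrier H. \<forall>b\<in>carrier H. imp H a (imp H b a) = unt H) \<and>
     (\<forall>a\<in>carrier H. \<forall>b\<in>carrier H. \<forall>c\<in>carrier H.
        imp H (imp H a (imp H b c)) (imp H (imp H a b) (imp H a c)) = unt H) \<and>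
     (\<forall>a\<in>carrier H. \<forall>b\<in>carrier H. imp H a b = unt H \<and> imp H b a = unt H \<longrightarrow> a = b)"

definition hilbert_le :: "('a, 'z) hilbert_scheme \<Rightarrow> 'a \<Rightarrow> 'a \<Rightarrow> bool" where
  "hilbert_le H a b \<longleftrightarrow> imp H a b = unt H"

definition hilbert_chain :: "('a, 'z) hilbert_scheme \<Rightarrow> bool" where
  "hilbert_chain H \<longleftrightarrow> hilbert_algebra H \<and>
     (\<forall>a\<in>carrier H. \<forall>b\<in>carrier H. hilbert_le H a b \<or> hilbert_le H b a)"

datatype trm = Var nat | Unt | Imp trm trm

primrec eval :: "('a, 'z) hilbert_scheme \<Rightarrow> (nat \<Rightarrow> 'a) \<Rightarrow> trm \<Rightarrow> 'a" where
  "eval H v (Var n) = v n"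
| "eval H v Unt = unt H"
| "eval H v (Imp s t) = imp H (eval H v s) (eval H v t)"

definition satisfies :: "('a, 'z) hilbert_scheme \<Rightarrow> trm \<Rightarrow> trm \<Rightarrow> bool" where
  "satisfies H s t \<longleftrightarrow> (\<forall>v\<in>UNIV \<rightarrow> carrier H. eval H v s = eval H v t)"

text \<open>The identities holding in all Hilbert chains. A definition cannot quantify over the carrier
  type, so only chains with carrier in \<^typ>\<open>nat\<close> occur here. This loses nothing: an
  identity that fails in some chain fails in a countable subchain; see
  \<open>chain_identity_satisfies\<close> and \<open>hilbert_chain_prelinear\<close> below.\<close>

definition chain_identity :: "trm \<Rightarrow> trm \<Rightarrow> bool" where
  "chain_identity s t \<longleftrightarrow> (\<forall>C :: nat hilbert. hilbert_chain C \<longrightarrow> satisfies C s t)"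

text \<open>The variety generated by the chains, as the class of models of all their identities.\<close>

definition prelinear_hilbert :: "('a, 'z) hilbert_scheme \<Rightarrow> bool" where
  "prelinear_hilbert H \<longleftrightarrow> hilbert_algebra H \<and>
     (\<forall>s t. chain_identity s t \<longrightarrow> satisfies H s t)"

definition bounded_prelinear_hilbert :: "('a, 'z) bhilbert_scheme \<Rightarrow> bool" where
  "bounded_prelinear_hilbert H \<longleftrightarrow> prelinear_hilbert H \<and> bot_elt H \<in> carrier H \<and>
     (\<forall>a\<in>carrier H. hilbert_le H (bot_elt H) a)"

definition PHil_hom :: "('a, 'y) hilbert_scheme \<Rightarrow> ('b, 'z) hilbert_scheme \<Rightarrow> ('a \<Rightarrow> 'b) set" where
  "PHil_hom A B = {f \<in> carrier A \<rightarrow> carrier B.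
     f (unt A) = unt B \<and>
     (\<forall>x\<in>carrier A. \<forall>y\<in>carrier A. f (imp A x y) = imp B (f x) (f y))}"

definition PHil0_hom :: "('a, 'y) bhilbert_scheme \<Rightarrow> ('b, 'z) bhilbert_scheme \<Rightarrow> ('a \<Rightarrow> 'b) set" where
  "PHil0_hom A B = {f \<in> PHil_hom A B. f (bot_elt A) = bot_elt B}"

text \<open>Coproducts. The universal property is stated with respect to the test objects whose carrier
  is a set of elements of the type \<open>'t\<close>. Mediating morphisms are taken extensional (undefined
  outside the carrier), so that the unique existence quantifier expresses uniqueness as a map on
  the carrier.\<close>

definition PHil_coproduct ::
  "'t itself \<Rightarrow> 'a hilbert \<Rightarrow> 'b hilbert \<Rightarrow> 'c hilbert \<Rightarrow> ('a \<Rightarrow> 'c) \<Rightarrow> ('b \<Rightarrow> 'c) \<Rightarrow> bool" where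
  "PHil_coproduct _ A B P j\<^sub>A j\<^sub>B \<longleftrightarrow>
     prelinear_hilbert P \<and> j\<^sub>A \<in> PHil_hom A P \<and> j\<^sub>B \<in> PHil_hom B P \<and>
     (\<forall>K :: 't hilbert. prelinear_hilbert K \<longrightarrow>
        (\<forall>f \<in> PHil_hom A K. \<forall>g \<in> PHil_hom B K.
           \<exists>!h. h \<in> PHil_hom P K \<inter> extensional (carrier P) \<and>
             (\<forall>x\<in>carrier A. h (j\<^sub>A x) = f x) \<and> (\<forall>y\<in>carrier B. h (j\<^sub>B y) = g y)))"

definition PHil0_coproduct ::
  "'t itself \<Rightarrow> 'a bhilbert \<Rightarrow> 'b bhilbert \<Rightarrow> 'c bhilbert \<Rightarrow> ('a \<Rightarrow> 'c) \<Rightarrow> ('b \<Rightarrow> 'c) \<Rightarrow> bool" where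
  "PHil0_coproduct _ A B P j\<^sub>A j\<^sub>B \<longleftrightarrow>
     bounded_prelinear_hilbert P \<and> j\<^sub>A \<in> PHil0_hom A P \<and> j\<^sub>B \<in> PHil0_hom B P \<and>
     (\<forall>K :: 't bhilbert. bounded_prelinear_hilbert K \<longrightarrow>
        (\<forall>f \<in> PHil0_hom A K. \<forall>g \<in> PHil0_hom B K.
           \<exists>!h. h \<in> PHil0_hom P K \<inter> extensional (carrier P) \<and>
             (\<forall>x\<in>carrier A. h (j\<^sub>A x) = f x) \<and> (\<forall>y\<in>carrier B. h (j\<^sub>B y) = g y)))"

text \<open>\<open>H\<^sup>0\<close>: the new element is \<^term>\<open>None\<close>, and the inclusion of \<open>H\<close> is \<^term>\<open>Some\<close>.\<close>

definition adjoin_zero :: "'a hilbert \<Rightarrow> 'a option bhilbert" where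
  "adjoin_zero H =
     \<lparr> carrier = insert None (Some ` carrier H),
       imp = (\<lambda>x y. case x of
                 None \<Rightarrow> Some (unt H)
               | Some h \<Rightarrow> (case y of None \<Rightarrow> None | Some k \<Rightarrow> Some (imp H h k))),
       unt = Some (unt H),
       bot_elt = None \<rparr>"

inductive_set gen :: "('a, 'z) hilbert_scheme \<Rightarrow> 'a set \<Rightarrow> 'a set"
  for H :: "('a, 'z) hilbert_scheme" and X :: "'a set" where
  incl: "x \<in> X \<Longrightarrow> x \<in> gen H X"
| unt: "unt H \<in> gen H X"
| imp: "x \<in> gen H X \<Longrightarrow> y \<in> gen H X \<Longrightarrow> imp H x y \<in> gen H X"

definition generated_subalgebra :: "('a, 'z) hilbert_scheme \<Rightarrow> 'a set \<Rightarrow> 'a hilbert" where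
  "generated_subalgebra H X = \<lparr> carrier = gen H X, imp = imp H, unt = unt H \<rparr>"


instance trm :: countable
  by countable_datatype

lemma eval_in_carrier:
  assumes "hilbert_algebra H" "v \<in> UNIV \<rightarrow> carrier H"
  shows "eval H v t \<in> carrier H"
  using assms by (induction t) (auto simp: hilbert_algebra_def)

lemma chain_identity_satisfies:
  assumes C: "hilbert_chain C" and st: "chain_identity s t"
  shows "satisfies C s t"
  unfolding satisfies_def
proof
  fix v :: "nat \<Rightarrow> _" assume v: "v \<in> UNIV \<rightarrow> carrier C"
  define S where "S = range (eval C v)"
  have cS: "countable S" unfolding S_def by simp
  define e where "e = to_nat_on S"
  define d where "d = from_nat_into S"
  have de: "d (e x) = x" if "x \<in> S" for x
    using that cS unfolding d_def e_def by simp
  have subC: "S \<subseteq> carrier C"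
    using eval_in_carrier[OF _ v] C by (auto simp: S_def hilbert_chain_def)
  have S_unt: "unt C \<in> S"
    unfolding S_def by (rule range_eqI[of _ _ Unt]) simp
  have S_imp: "imp C x y \<in> S" if xy: "x \<in> S" "y \<in> S" for x y
  proof -
    obtain p q where "x = eval C v p" "y = eval C v q" using xy by (auto simp: S_def)
    then show ?thesis unfolding S_def by (intro range_eqI[of _ _ "Imp p q"]) simp
  qed
  define N where "N = \<lparr>carrier = e ` S, imp = (\<lambda>x y. e (imp C (d x) (d y))), unt = e (unt C)\<rparr>"
  have e_eq: "e x = e y \<longleftrightarrow> x = y" if "x \<in> S" "y \<in> S" for x y
    using de that by metis
  have "hilbert_chain N"
    using C subC unfolding hilbert_chain_def hilbert_algebra_def hilbert_le_def N_def
    by (simp add: de e_eq S_unt S_imp subset_iff)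
  then have sat: "satisfies N s t" using st by (simp add: chain_identity_def)
  have S_eval: "eval C v p \<in> S" for p by (simp add: S_def)
  have ev: "eval N (e \<circ> v) p = e (eval C v p)" for p
    by (induction p) (simp_all add: N_def de S_eval)
  have "v n \<in> S" for n using S_eval[of "Var n"] by simp
  then have "e \<circ> v \<in> UNIV \<rightarrow> carrier N" by (simp add: N_def)
  then have "eval N (e \<circ> v) s = eval N (e \<circ> v) t"
    using sat unfolding satisfies_def by blast
  then have "e (eval C v s) = e (eval C v t)" unfolding ev .
  then show "eval C v s = eval C v t" by (simp add: e_eq S_eval)
qed

lemma hilbert_chain_prelinear: "hilbert_chain C \<Longrightarrow> prelinear_hilbert C"
  using chain_identity_satisfies by (auto simp: prelinear_hilbert_def hilbert_chain_def)

end

theory Submission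
  imports Defs
begin

text \<open>
  A pair of homomorphisms \<open>f : G \<rightarrow> K\<close>, \<open>g : H \<rightarrow> K\<close> in \<open>PHil\<close> extends, by sending \<open>0\<close> to \<open>0\<close>, to
  a pair \<open>G\<^sup>0 \<rightarrow> K\<^sup>0\<close>, \<open>H\<^sup>0 \<rightarrow> K\<^sup>0\<close> in \<open>PHil\<^sub>0\<close>. The universal property of the bounded coproduct
  \<open>P\<close> turns it into one morphism \<open>P \<rightarrow> K\<^sup>0\<close>. Since \<open>K\<close> is closed under \<open>\<rightarrow>\<close> and \<open>1\<close> in \<open>K\<^sup>0\<close>, this
  morphism maps the subalgebra generated by the images of \<open>G\<close> and \<open>H\<close> into \<open>K\<close>, and its
  restriction is the mediating morphism; it is unique because homomorphisms that agree on
  generators are equal. The injections are split by mediating morphisms: for \<open>k\<^sub>G\<close> take \<open>K = G\<close>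
  with the identity of \<open>G\<close> and the constant \<open>1\<close> on \<open>H\<close>.

  Two points need an argument. First, \<open>K\<^sup>0\<close> must be prelinear when \<open>K\<close> is
  (\<open>prelinear_adjoin_zero\<close>). Putting \<open>0\<close> for some variables of a term and computing as in
  \<open>K\<^sup>0\<close> leaves either \<open>0\<close> or a term in the remaining variables, and which of the two it is does
  not depend on \<open>K\<close>. If \<open>s = t\<close> holds in all chains, it holds in \<open>C\<^sup>0\<close> for every chain \<open>C\<close>, since
  \<open>C\<^sup>0\<close> is a chain; hence the reduced terms of \<open>s\<close> and \<open>t\<close> are both \<open>0\<close> or form again an
  identity of all chains, which holds in \<open>K\<close>.

  Secondly, the universal property of \<open>P\<close> is available only for test objects carried by subsets
  of one infinite type, while \<open>K\<close> may live on any type. As \<open>G\<close> and \<open>H\<close> are countable, \<open>K\<close> can be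
  replaced by its countable subalgebra generated by the images of \<open>f\<close> and \<open>g\<close>, and a countable
  algebra has a copy on every infinite type (\<open>PHil0_coproduct_mediating_countable\<close>).
\<close>

section \<open>Homomorphisms and subalgebras\<close>

lemma PHil_homI:
  assumes "\<And>x. x \<in> carrier A \<Longrightarrow> f x \<in> carrier B" "f (unt A) = unt B"
    and "\<And>x y. x \<in> carrier A \<Longrightarrow> y \<in> carrier A \<Longrightarrow> f (imp A x y) = imp B (f x) (f y)"
  shows "f \<in> PHil_hom A B"
  using assms by (simp add: PHil_hom_def)

lemma PHil_homD:
  assumes "f \<in> PHil_hom A B"
  shows "x \<in> carrier A \<Longrightarrow> f x \<in> carrier B" "f (unt A) = unt B"
    and "x \<in> carrier A \<Longrightarrow> y \<in> carrier A \<Longrightarrow> f (imp A x y) = imp B (f x) (f y)"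
  using assms by (auto simp: PHil_hom_def)

lemma hilbert_algebra_closed:
  assumes "hilbert_algebra H"
  shows "unt H \<in> carrier H" "a \<in> carrier H \<Longrightarrow> b \<in> carrier H \<Longrightarrow> imp H a b \<in> carrier H"
  using assms by (simp_all add: hilbert_algebra_def)

lemma hilbert_algebra_axioms:
  assumes "hilbert_algebra H" "a \<in> carrier H" "b \<in> carrier H"
  shows "imp H a (imp H b a) = unt H"
    and "c \<in> carrier H \<Longrightarrow>
      imp H (imp H a (imp H b c)) (imp H (imp H a b) (imp H a c)) = unt H"
    and "imp H a b = unt H \<Longrightarrow> imp H b a = unt H \<Longrightarrow> a = b"
  using assms by (simp_all add: hilbert_algebra_def)

lemma hilbert_top:
  assumes "hilbert_algebra H" "a \<in> carrier H"
  shows "imp H a (unt H) = unt H"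
proof -
  note c = hilbert_algebra_closed[OF assms(1)] and ax = hilbert_algebra_axioms[OF assms(1)]
  define u where "u = imp H a (unt H)"
  have u: "u \<in> carrier H" using c assms(2) by (simp add: u_def)
  have "imp H (unt H) u = unt H" using ax(1) c assms(2) by (simp add: u_def)
  moreover from this have "imp H u (imp H (unt H) u) = imp H u (unt H)" by simp
  then have "imp H u (unt H) = unt H" using ax(1)[OF u c(1)] by simp
  ultimately show ?thesis using ax(3)[OF u c(1)] by (simp add: u_def)
qed

lemma hilbert_refl:
  assumes "hilbert_algebra H" "a \<in> carrier H"
  shows "imp H a a = unt H"
proof -
  note c = hilbert_algebra_closed[OF assms(1)] and ax = hilbert_algebra_axioms[OF assms(1)]
  define u where "u = imp H a a"
  have u: "u \<in> carrier H" using c assms(2) by (simp add: u_def)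
  have "imp H a u = unt H" "imp H a (imp H u a) = unt H"
    using ax(1) assms(2) u by (simp_all add: u_def)
  moreover have "imp H (imp H a (imp H u a)) (imp H (imp H a u) (imp H a a)) = unt H"
    using ax(2) assms(2) u by blast
  ultimately have "imp H (unt H) (imp H (unt H) u) = unt H" by (simp add: u_def)
  then have "imp H (unt H) u = unt H"
    using ax(3) hilbert_top[OF assms(1)] u c by simp
  then have "u = unt H"
    using ax(3) hilbert_top[OF assms(1)] u c by simp
  then show ?thesis by (simp add: u_def)
qed

lemma PHil_hom_const_unt:
  assumes "hilbert_algebra B"
  shows "(\<lambda>_. unt B) \<in> PHil_hom A B"
  using assms by (intro PHil_homI) (simp_all add: hilbert_algebra_closed hilbert_refl)

text \<open>Injective homomorphisms reflect identities and antisymmetry. One lemma thus covers both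
  subalgebras and isomorphic copies.\<close>

lemma prelinear_embedding:
  assumes K: "prelinear_hilbert K" and m: "m \<in> PHil_hom N K" and inj: "inj_on m (carrier N)"
    and unt: "unt N \<in> carrier N"
    and imp: "\<And>x y. x \<in> carrier N \<Longrightarrow> y \<in> carrier N \<Longrightarrow> imp N x y \<in> carrier N"
  shows "prelinear_hilbert N"
proof -
  have K': "hilbert_algebra K" using K by (simp add: prelinear_hilbert_def)
  note hom = PHil_homD[OF m] and ax = hilbert_algebra_axioms[OF K']
  have eq: "x = y" if "m x = m y" "x \<in> carrier N" "y \<in> carrier N" for x y
    using inj that by (auto dest: inj_onD)
  have N': "hilbert_algebra N"
    unfolding hilbert_algebra_def
  proof (intro conjI ballI impI)
    fix a b assume a: "a \<in> carrier N" and b: "b \<in> carrier N"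
    show "imp N a (imp N b a) = unt N"
      by (rule eq) (simp_all add: a b unt imp hom ax)
    show "a = b" if "imp N a b = unt N \<and> imp N b a = unt N"
    proof (rule eq[OF _ a b])
      have "imp K (m a) (m b) = unt K" "imp K (m b) (m a) = unt K"
        using that hom a b by metis+
      then show "m a = m b" using ax(3) hom a b by blast
    qed
    fix c assume c: "c \<in> carrier N"
    show "imp N (imp N a (imp N b c)) (imp N (imp N a b) (imp N a c)) = unt N"
      by (rule eq) (simp_all add: a b c unt imp hom ax)
  qed (use unt imp in auto)
  have "satisfies N s t" if "chain_identity s t" for s t
    unfolding satisfies_def
  proof
    fix v :: "nat \<Rightarrow> _" assume v: "v \<in> UNIV \<rightarrow> carrier N"
    have in_N: "eval N v p \<in> carrier N" for p using eval_in_carrier[OF N' v] .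
    have ev: "m (eval N v p) = eval K (m \<circ> v) p" for p
      by (induction p) (simp_all add: hom in_N)
    have "m \<circ> v \<in> UNIV \<rightarrow> carrier K" using v hom(1) by (simp add: Pi_iff)
    then have "eval K (m \<circ> v) s = eval K (m \<circ> v) t"
      using K that unfolding prelinear_hilbert_def satisfies_def by blast
    then show "eval N v s = eval N v t" using eq in_N by (simp add: ev)
  qed
  with N' show ?thesis by (simp add: prelinear_hilbert_def)
qed

lemma generated_subalgebra_simps [simp]:
  "carrier (generated_subalgebra H X) = gen H X"
  "imp (generated_subalgebra H X) = imp H"
  "unt (generated_subalgebra H X) = unt H"
  by (simp_all add: generated_subalgebra_def)

lemma gen_subset_carrier:
  assumes "hilbert_algebra H" "X \<subseteq> carrier H"
  shows "gen H X \<subseteq> carrier H"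
proof
  fix x assume "x \<in> gen H X"
  then show "x \<in> carrier H"
    using assms by induction (auto simp: hilbert_algebra_closed)
qed

lemma prelinear_generated_subalgebra:
  assumes "prelinear_hilbert H" "X \<subseteq> carrier H"
  shows "prelinear_hilbert (generated_subalgebra H X)"
proof (rule prelinear_embedding[OF assms(1), where m = "\<lambda>x. x"])
  have "gen H X \<subseteq> carrier H"
    using assms by (simp add: gen_subset_carrier prelinear_hilbert_def)
  then show "(\<lambda>x. x) \<in> PHil_hom (generated_subalgebra H X) H"
    by (intro PHil_homI) auto
qed (auto intro: gen.unt gen.imp)

lemma PHil_hom_into_generated:
  assumes f: "f \<in> PHil_hom A H" and sub: "f ` carrier A \<subseteq> X"
  shows "f \<in> PHil_hom A (generated_subalgebra H X)"
  using sub by (intro PHil_homI) (auto simp: PHil_homD[OF f] intro: gen.incl)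

lemma PHil_hom_eq_on_gen:
  assumes h: "h \<in> PHil_hom (generated_subalgebra H X) K"
    and h': "h' \<in> PHil_hom (generated_subalgebra H X) K"
    and eq: "\<And>x. x \<in> X \<Longrightarrow> h x = h' x" and x: "x \<in> gen H X"
  shows "h x = h' x"
  using x
proof induction
  case (incl x)
  then show ?case by (rule eq)
next
  case unt
  show ?case using PHil_homD(2)[OF h] PHil_homD(2)[OF h'] by simp
next
  case (imp x y)
  then show ?case using PHil_homD(3)[OF h] PHil_homD(3)[OF h'] by simp
qed

text \<open>There are only countably many terms in the generators.\<close>

lemma countable_gen:
  assumes "countable X"
  shows "countable (gen H X)"
proof -
  define v where "v = from_nat_into (insert (unt H) X)"
  have ran: "range v = insert (unt H) X"
    using assms unfolding v_def by (intro range_from_nat_into) simp_all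
  have "gen H X \<subseteq> range (eval H v)"
  proof
    fix x assume "x \<in> gen H X"
    then show "x \<in> range (eval H v)"
    proof induction
      case (incl x)
      then obtain n where "x = v n" using ran by (metis insertCI imageE)
      then show ?case by (intro range_eqI[of _ _ "Var n"]) simp
    next
      case unt
      show ?case by (intro range_eqI[of _ _ Unt]) simp
    next
      case (imp x y)
      then obtain p q where "x = eval H v p" "y = eval H v q" by blast
      then show ?case by (intro range_eqI[of _ _ "Imp p q"]) simp
    qed
  qed
  then show ?thesis by (rule countable_subset) simp
qed

section \<open>Adjoining a zero\<close>

lemma adjoin_zero_simps [simp]:
  "carrier (adjoin_zero H) = insert None (Some ` carrier H)"
  "imp (adjoin_zero H) None y = Some (unt H)"
  "imp (adjoin_zero H) (Some a) None = None"
  "imp (adjoin_zero H) (Some a) (Some b) = Some (imp H a b)"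
  "unt (adjoin_zero H) = Some (unt H)"
  "bot_elt (adjoin_zero H) = None"
  by (simp_all add: adjoin_zero_def)

lemma hilbert_algebra_adjoin_zero:
  assumes "hilbert_algebra H"
  shows "hilbert_algebra (adjoin_zero H)"
  using assms unfolding hilbert_algebra_def[of "adjoin_zero H"]
  by (auto simp: hilbert_algebra_closed hilbert_algebra_axioms hilbert_top hilbert_refl
      dest: hilbert_algebra_axioms(3))

lemma hilbert_chain_adjoin_zero:
  assumes "hilbert_chain C"
  shows "hilbert_chain (adjoin_zero C)"
  using assms hilbert_algebra_adjoin_zero[of C]
  by (auto simp: hilbert_chain_def hilbert_le_def)

text \<open>The symbolic value of a term in \<open>K\<^sup>0\<close> when the variables in \<open>S\<close> take the value \<open>0\<close> and the
  others take values in \<open>K\<close>; it is the same for all \<open>K\<close>.\<close>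

primrec zero_subst :: "nat set \<Rightarrow> trm \<Rightarrow> trm option" where
  "zero_subst S (Var n) = (if n \<in> S then None else Some (Var n))"
| "zero_subst S Unt = Some Unt"
| "zero_subst S (Imp s t) =
     (case zero_subst S s of
        None \<Rightarrow> Some Unt
      | Some s' \<Rightarrow> (case zero_subst S t of None \<Rightarrow> None | Some t' \<Rightarrow> Some (Imp s' t')))"

lemma eval_adjoin_zero:
  "eval (adjoin_zero K) (\<lambda>n. if n \<in> S then None else Some (v n)) t =
     map_option (eval K v) (zero_subst S t)"
  by (induction t) (simp_all split: option.split)

text \<open>Since \<open>C\<^sup>0\<close> is a chain for every chain \<open>C\<close>, zero substitution turns identities of chains into
  identities of chains.\<close>

lemma chain_identity_zero_subst:
  assumes "chain_identity s t"
  shows "rel_option chain_identity (zero_subst S s) (zero_subst S t)"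
proof -
  have eq: "map_option (eval C v) (zero_subst S s) = map_option (eval C v) (zero_subst S t)"
    if C: "hilbert_chain C" and v: "v \<in> UNIV \<rightarrow> carrier C" for C :: "nat hilbert" and v
  proof -
    have "satisfies (adjoin_zero C) s t"
      using chain_identity_satisfies[OF hilbert_chain_adjoin_zero[OF C] assms] .
    moreover have "(\<lambda>n. if n \<in> S then None else Some (v n)) \<in> UNIV \<rightarrow> carrier (adjoin_zero C)"
      using v by (simp add: Pi_iff)
    ultimately show ?thesis unfolding satisfies_def eval_adjoin_zero[symmetric] by blast
  qed
  \<comment> \<open>Any chain tells whether the reduced terms are \<open>0\<close>; the trivial one will do.\<close>
  define T :: "nat hilbert" where "T = \<lparr>carrier = {0}, imp = (\<lambda>_ _. 0), unt = 0\<rparr>"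
  have "hilbert_chain T"
    by (simp add: T_def hilbert_chain_def hilbert_algebra_def hilbert_le_def)
  from eq[OF this, of "\<lambda>_. 0"]
  have "zero_subst S s = None \<longleftrightarrow> zero_subst S t = None"
    by (auto simp: T_def)
  then show ?thesis
    using eq by (cases "zero_subst S s"; cases "zero_subst S t")
      (auto simp: chain_identity_def satisfies_def)
qed

lemma prelinear_adjoin_zero:
  assumes K: "prelinear_hilbert K"
  shows "prelinear_hilbert (adjoin_zero K)"
proof -
  have K': "hilbert_algebra K" using K by (simp add: prelinear_hilbert_def)
  have "satisfies (adjoin_zero K) s t" if st: "chain_identity s t" for s t
    unfolding satisfies_def
  proof
    fix w :: "nat \<Rightarrow> _" assume w: "w \<in> UNIV \<rightarrow> carrier (adjoin_zero K)"
    define S where "S = {n. w n = None}"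
    define v where "v n = (case w n of None \<Rightarrow> unt K | Some a \<Rightarrow> a)" for n
    have v: "v \<in> UNIV \<rightarrow> carrier K"
    proof
      fix n
      have "w n \<in> insert None (Some ` carrier K)" using w by auto
      then show "v n \<in> carrier K"
        using hilbert_algebra_closed(1)[OF K'] by (auto simp: v_def)
    qed
    have w_eq: "w = (\<lambda>n. if n \<in> S then None else Some (v n))"
      by (auto simp: S_def v_def fun_eq_iff)
    have "map_option (eval K v) (zero_subst S s) = map_option (eval K v) (zero_subst S t)"
      using chain_identity_zero_subst[OF st, of S] K v
      by (cases rule: option.rel_cases)
        (auto simp: prelinear_hilbert_def satisfies_def)
    then show "eval (adjoin_zero K) w s = eval (adjoin_zero K) w t"
      unfolding w_eq eval_adjoin_zero .
  qed
  with hilbert_algebra_adjoin_zero[OF K'] show ?thesis by (simp add: prelinear_hilbert_def)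
qed

lemma bounded_prelinear_adjoin_zero:
  "prelinear_hilbert K \<Longrightarrow> bounded_prelinear_hilbert (adjoin_zero K)"
  by (simp add: bounded_prelinear_hilbert_def hilbert_le_def prelinear_adjoin_zero)

lemma map_option_PHil0_hom:
  assumes f: "f \<in> PHil_hom A K"
  shows "map_option f \<in> PHil0_hom (adjoin_zero A) (adjoin_zero K)"
  unfolding PHil0_hom_def by (auto intro!: PHil_homI simp: PHil_homD[OF f])

section \<open>Mediating morphisms\<close>

text \<open>A countable test object on any type has a copy inside the infinite type for which the
  universal property is given.\<close>

lemma PHil0_coproduct_mediating_countable:
  assumes P: "PHil0_coproduct TYPE('u::infinite) A B P j\<^sub>A j\<^sub>B"
    and L: "bounded_prelinear_hilbert L" and "countable (carrier L)"
    and f: "f \<in> PHil0_hom A L" and g: "g \<in> PHil0_hom B L"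
  obtains h where "h \<in> PHil0_hom P L" "\<And>x. x \<in> carrier A \<Longrightarrow> h (j\<^sub>A x) = f x"
    "\<And>y. y \<in> carrier B \<Longrightarrow> h (j\<^sub>B y) = g y"
proof -
  obtain \<iota> :: "nat \<Rightarrow> 'u" where \<iota>: "inj \<iota>"
    using infinite_countable_subset[OF infinite_UNIV] by blast
  define e where "e = \<iota> \<circ> to_nat_on (carrier L)"
  define d where "d = inv_into (carrier L) e"
  have "inj_on e (carrier L)"
    unfolding e_def using \<iota> assms(3)
    by (intro comp_inj_on inj_on_to_nat_on) (auto intro: inj_on_subset)
  then have de [simp]: "d (e x) = x" if "x \<in> carrier L" for x
    using that by (simp add: d_def)
  define N :: "'u bhilbert" where
    "N = \<lparr>carrier = e ` carrier L, imp = (\<lambda>x y. e (imp L (d x) (d y))), unt = e (unt L),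
          bot_elt = e (bot_elt L)\<rparr>"
  have N_simps [simp]: "carrier N = e ` carrier L" "imp N x y = e (imp L (d x) (d y))"
    "unt N = e (unt L)" "bot_elt N = e (bot_elt L)" for x y
    by (simp_all add: N_def)
  have L': "prelinear_hilbert L" "hilbert_algebra L" "bot_elt L \<in> carrier L"
    "\<And>x. x \<in> carrier L \<Longrightarrow> imp L (bot_elt L) x = unt L"
    using L by (simp_all add: bounded_prelinear_hilbert_def prelinear_hilbert_def hilbert_le_def)
  note closed [simp] = hilbert_algebra_closed[OF L'(2)]
  have d: "d \<in> PHil0_hom N L"
    unfolding PHil0_hom_def by (auto intro!: PHil_homI simp: L')
  have "prelinear_hilbert N"
    using d by (intro prelinear_embedding[OF L'(1), of d])
      (auto simp: PHil0_hom_def inj_on_def)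
  then have N: "bounded_prelinear_hilbert N"
    by (auto simp: bounded_prelinear_hilbert_def hilbert_le_def L')
  have comp_f: "e \<circ> f \<in> PHil0_hom A N"
    using f unfolding PHil0_hom_def by (auto intro!: PHil_homI simp: PHil_homD)
  have comp_g: "e \<circ> g \<in> PHil0_hom B N"
    using g unfolding PHil0_hom_def by (auto intro!: PHil_homI simp: PHil_homD)
  obtain h where h: "h \<in> PHil0_hom P N" "\<And>x. x \<in> carrier A \<Longrightarrow> h (j\<^sub>A x) = e (f x)"
    "\<And>y. y \<in> carrier B \<Longrightarrow> h (j\<^sub>B y) = e (g y)"
  proof -
    have "\<exists>!h. h \<in> PHil0_hom P N \<inter> extensional (carrier P) \<and>
        (\<forall>x\<in>carrier A. h (j\<^sub>A x) = (e \<circ> f) x) \<and> (\<forall>y\<in>carrier B. h (j\<^sub>B y) = (e \<circ> g) y)"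
      by (rule P[unfolded PHil0_coproduct_def, THEN conjunct2, THEN conjunct2, THEN conjunct2,
            rule_format, OF N comp_f comp_g])
    from ex1_implies_ex[OF this] show thesis
    proof (elim exE conjE)
      fix h
      assume "h \<in> PHil0_hom P N \<inter> extensional (carrier P)"
        "\<forall>x\<in>carrier A. h (j\<^sub>A x) = (e \<circ> f) x" "\<forall>y\<in>carrier B. h (j\<^sub>B y) = (e \<circ> g) y"
      then show thesis by (intro that[of h]) simp_all
    qed
  qed
  show ?thesis
  proof
    show "d \<circ> h \<in> PHil0_hom P L"
      using h(1) d unfolding PHil0_hom_def
      by (auto intro!: PHil_homI simp: PHil_homD simp del: N_simps)
    show "(d \<circ> h) (j\<^sub>A x) = f x" if "x \<in> carrier A" for x
      using that PHil_homD(1)[of f A L] f h(2) by (simp add: PHil0_hom_def)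
    show "(d \<circ> h) (j\<^sub>B y) = g y" if "y \<in> carrier B" for y
      using that PHil_homD(1)[of g B L] g h(3) by (simp add: PHil0_hom_def)
  qed
qed

text \<open>The test object for \<open>P\<close> is \<open>M\<^sup>0\<close>, where \<open>M\<close> is the subalgebra of \<open>K\<close> generated by the images
  of \<open>f\<close> and \<open>g\<close>: it is countable whatever the size of \<open>K\<close>, and its bottom lies outside \<open>M\<close>,
  so that the values on the generated subalgebra can be read in \<open>K\<close>.\<close>

lemma PHil_mediating:
  fixes A :: "'a hilbert" and B :: "'b hilbert" and P :: "'c bhilbert" and K :: "'d hilbert"
  assumes P: "PHil0_coproduct TYPE('u::infinite) (adjoin_zero A) (adjoin_zero B) P j\<^sub>A j\<^sub>B"
    and cA: "countable (carrier A)" and cB: "countable (carrier B)"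
    and K: "prelinear_hilbert K" and f: "f \<in> PHil_hom A K" and g: "g \<in> PHil_hom B K"
  defines "Q \<equiv> generated_subalgebra P
      ((j\<^sub>A \<circ> Some) ` carrier A \<union> (j\<^sub>B \<circ> Some) ` carrier B)"
  shows "\<exists>h\<in>PHil_hom Q K. (\<forall>x\<in>carrier A. h ((j\<^sub>A \<circ> Some) x) = f x) \<and>
      (\<forall>y\<in>carrier B. h ((j\<^sub>B \<circ> Some) y) = g y)"
proof -
  define X where "X = (j\<^sub>A \<circ> Some) ` carrier A \<union> (j\<^sub>B \<circ> Some) ` carrier B"
  define Y where "Y = f ` carrier A \<union> g ` carrier B"
  define M where "M = generated_subalgebra K Y"
  have Y: "Y \<subseteq> carrier K" using f g by (auto simp: Y_def PHil_homD)
  have M: "prelinear_hilbert M"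
    unfolding M_def by (rule prelinear_generated_subalgebra[OF K Y])
  have "countable (carrier M)"
    using cA cB by (simp add: M_def Y_def countable_gen)
  then have cM: "countable (carrier (adjoin_zero M))" by simp
  have fM: "map_option f \<in> PHil0_hom (adjoin_zero A) (adjoin_zero M)"
    unfolding M_def
    by (rule map_option_PHil0_hom[OF PHil_hom_into_generated[OF f]]) (simp add: Y_def)
  have gM: "map_option g \<in> PHil0_hom (adjoin_zero B) (adjoin_zero M)"
    unfolding M_def
    by (rule map_option_PHil0_hom[OF PHil_hom_into_generated[OF g]]) (simp add: Y_def)
  obtain h where h: "h \<in> PHil0_hom P (adjoin_zero M)"
    and hf: "\<And>x. x \<in> carrier (adjoin_zero A) \<Longrightarrow> h (j\<^sub>A x) = map_option f x"
    and hg: "\<And>y. y \<in> carrier (adjoin_zero B) \<Longrightarrow> h (j\<^sub>B y) = map_option g y"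
    using PHil0_coproduct_mediating_countable[OF P bounded_prelinear_adjoin_zero[OF M] cM fM gM]
    by blast
  have h': "h \<in> PHil_hom P (adjoin_zero M)" using h by (simp add: PHil0_hom_def)
  have P': "hilbert_algebra P" "j\<^sub>A \<in> PHil_hom (adjoin_zero A) P" "j\<^sub>B \<in> PHil_hom (adjoin_zero B) P"
    using P by (simp_all add: PHil0_coproduct_def bounded_prelinear_hilbert_def
        prelinear_hilbert_def PHil0_hom_def)
  have "X \<subseteq> carrier P" unfolding X_def by (auto simp: P'(2,3)[THEN PHil_homD(1)])
  then have sub: "gen P X \<subseteq> carrier P" by (rule gen_subset_carrier[OF P'(1)])
  note hom = PHil_homD(2,3)[OF h']
  \<comment> \<open>On the generated subalgebra the value \<open>0\<close> is never taken.\<close>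
  have some: "h x \<in> Some ` carrier K" if "x \<in> gen P X" for x
    using that
  proof induction
    case (incl x)
    then show ?case using f g by (auto simp: X_def hf hg PHil_homD)
  next
    case unt
    show ?case using hom(1) K
      by (simp add: M_def hilbert_algebra_closed prelinear_hilbert_def)
  next
    case (imp x y)
    then have "h (Defs.imp P x y) = Defs.imp (adjoin_zero M) (h x) (h y)"
      using hom(2) sub by blast
    then show ?case using imp.IH K
      by (auto simp: M_def hilbert_algebra_closed prelinear_hilbert_def)
  qed
  have "the \<circ> h \<in> PHil_hom Q K"
  proof (rule PHil_homI)
    show "(the \<circ> h) (unt Q) = unt K" using hom(1) by (simp add: Q_def M_def)
    fix x assume "x \<in> carrier Q"
    then have x: "x \<in> gen P X" by (simp add: Q_def X_def)
    show "(the \<circ> h) x \<in> carrier K" using some[OF x] by auto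
    fix y assume "y \<in> carrier Q"
    then have y: "y \<in> gen P X" by (simp add: Q_def X_def)
    have "h (imp P x y) = imp (adjoin_zero M) (h x) (h y)"
      using hom(2) sub x y by blast
    then show "(the \<circ> h) (imp Q x y) = imp K ((the \<circ> h) x) ((the \<circ> h) y)"
      using some[OF x] some[OF y] by (auto simp: Q_def M_def)
  qed
  then show ?thesis by (rule bexI[rotated]) (simp add: hf hg)
qed

section \<open>The coproduct of unbounded algebras\<close>

theorem mainTheorem9:
  fixes G :: "'a hilbert" and H :: "'b hilbert" and P :: "'c bhilbert"
    and j\<^sub>G :: "'a option \<Rightarrow> 'c" and j\<^sub>H :: "'b option \<Rightarrow> 'c"
    and k\<^sub>G :: "'a \<Rightarrow> 'c" and k\<^sub>H :: "'b \<Rightarrow> 'c" and GH :: "'c hilbert"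
  assumes "prelinear_hilbert G" and "finite (carrier G)"
    and "prelinear_hilbert H" and "finite (carrier H)"
    and "PHil0_coproduct TYPE('u::infinite) (adjoin_zero G) (adjoin_zero H) P j\<^sub>G j\<^sub>H"
    and "k\<^sub>G = j\<^sub>G \<circ> Some" and "k\<^sub>H = j\<^sub>H \<circ> Some"
    and "GH = generated_subalgebra P (k\<^sub>G ` carrier G \<union> k\<^sub>H ` carrier H)"
  shows "inj_on k\<^sub>G (carrier G) \<and> inj_on k\<^sub>H (carrier H) \<and>
         PHil_coproduct TYPE('d) G H GH k\<^sub>G k\<^sub>H"
proof -
  note P = assms(5)
  have cG: "countable (carrier G)" and cH: "countable (carrier H)"
    using assms(2,4) by (simp_all add: countable_finite)
  note mediating = PHil_mediating[OF P cG cH, folded assms(6,7), folded assms(8)]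
  have G': "hilbert_algebra G" and H': "hilbert_algebra H"
    using assms(1,3) by (simp_all add: prelinear_hilbert_def)
  have id_G: "(\<lambda>x. x) \<in> PHil_hom G G" and id_H: "(\<lambda>y. y) \<in> PHil_hom H H"
    by (simp_all add: PHil_hom_def)
  have injG: "inj_on k\<^sub>G (carrier G)"
    using mediating[OF assms(1) id_G PHil_hom_const_unt[OF G']]
  proof (elim bexE conjE)
    fix r assume "\<forall>x\<in>carrier G. r (k\<^sub>G x) = x"
    then show ?thesis by (intro inj_on_inverseI[where g = r]) simp
  qed
  have injH: "inj_on k\<^sub>H (carrier H)"
    using mediating[OF assms(3) PHil_hom_const_unt[OF H'] id_H]
  proof (elim bexE conjE)
    fix r assume "\<forall>y\<in>carrier H. r (k\<^sub>H y) = y"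
    then show ?thesis by (intro inj_on_inverseI[where g = r]) simp
  qed
  define X where "X = k\<^sub>G ` carrier G \<union> k\<^sub>H ` carrier H"
  have GH: "GH = generated_subalgebra P X" using assms(8) by (simp add: X_def)
  have P': "prelinear_hilbert P"
    and jG: "j\<^sub>G \<in> PHil_hom (adjoin_zero G) P" and jH: "j\<^sub>H \<in> PHil_hom (adjoin_zero H) P"
    using P by (simp_all add: PHil0_coproduct_def bounded_prelinear_hilbert_def PHil0_hom_def)
  have kG: "k\<^sub>G \<in> PHil_hom G P"
    using PHil_homD(1,2)[OF jG] PHil_homD(3)[OF jG, of "Some _" "Some _"]
    by (intro PHil_homI) (auto simp: assms(6))
  have kH: "k\<^sub>H \<in> PHil_hom H P"
    using PHil_homD(1,2)[OF jH] PHil_homD(3)[OF jH, of "Some _" "Some _"]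
    by (intro PHil_homI) (auto simp: assms(7))
  have "X \<subseteq> carrier P" using kG kH by (auto simp: X_def PHil_homD)
  then have "prelinear_hilbert GH"
    unfolding GH by (rule prelinear_generated_subalgebra[OF P'])
  moreover have "k\<^sub>G \<in> PHil_hom G GH" "k\<^sub>H \<in> PHil_hom H GH"
    unfolding GH using kG kH by (auto intro!: PHil_hom_into_generated simp: X_def)
  moreover have "\<exists>!h. h \<in> PHil_hom GH K \<inter> extensional (carrier GH) \<and>
      (\<forall>x\<in>carrier G. h (k\<^sub>G x) = f x) \<and> (\<forall>y\<in>carrier H. h (k\<^sub>H y) = g y)"
    if K: "prelinear_hilbert K" and f: "f \<in> PHil_hom G K" and g: "g \<in> PHil_hom H K"
    for K :: "'d hilbert" and f g
  proof (rule ex_ex1I)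
    have in_GH: "k\<^sub>G x \<in> carrier GH" if "x \<in> carrier G" for x
      using that by (auto simp: GH X_def intro: gen.incl)
    have in_GH': "k\<^sub>H y \<in> carrier GH" if "y \<in> carrier H" for y
      using that by (auto simp: GH X_def intro: gen.incl)
    have restr: "restrict h (carrier GH) \<in> PHil_hom GH K" if h: "h \<in> PHil_hom GH K" for h
      using PHil_homD[OF h] by (intro PHil_homI) (auto simp: GH intro: gen.unt gen.imp)
    show "\<exists>h. h \<in> PHil_hom GH K \<inter> extensional (carrier GH) \<and>
        (\<forall>x\<in>carrier G. h (k\<^sub>G x) = f x) \<and> (\<forall>y\<in>carrier H. h (k\<^sub>H y) = g y)"
      using mediating[OF K f g]
    proof (elim bexE conjE)
      fix h
      assume "h \<in> PHil_hom GH K" "\<forall>x\<in>carrier G. h (k\<^sub>G x) = f x"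
        "\<forall>y\<in>carrier H. h (k\<^sub>H y) = g y"
      then show ?thesis
        by (intro exI[of _ "restrict h (carrier GH)"]) (simp add: restr in_GH in_GH')
    qed
  next
    fix h h'
    assume h: "h \<in> PHil_hom GH K \<inter> extensional (carrier GH) \<and>
        (\<forall>x\<in>carrier G. h (k\<^sub>G x) = f x) \<and> (\<forall>y\<in>carrier H. h (k\<^sub>H y) = g y)"
      and h': "h' \<in> PHil_hom GH K \<inter> extensional (carrier GH) \<and>
        (\<forall>x\<in>carrier G. h' (k\<^sub>G x) = f x) \<and> (\<forall>y\<in>carrier H. h' (k\<^sub>H y) = g y)"
    show "h = h'"
    proof (rule extensionalityI)
      fix x assume "x \<in> carrier GH"
      then have x: "x \<in> gen P X" by (simp add: GH)
      have hom: "h \<in> PHil_hom (generated_subalgebra P X) K"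
        "h' \<in> PHil_hom (generated_subalgebra P X) K"
        using h h' unfolding GH by blast+
      have "h z = h' z" if "z \<in> X" for z
        using that unfolding X_def by (elim UnE imageE) (simp_all add: h h')
      from PHil_hom_eq_on_gen[OF hom this x] show "h x = h' x" .
    qed (use h h' in auto)
  qed
  ultimately have "PHil_coproduct TYPE('d) G H GH k\<^sub>G k\<^sub>H"
    unfolding PHil_coproduct_def by (intro conjI allI impI ballI) assumption+
  with injG injH show ?thesis by blast
qed

end
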